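(* Let $p$ be a prime number, $n,d\geq1$ integers, and $u$ an integer with $(p,u)=1$. Let $A=A(p,n,d,u)=(a_{ij})_{1\leq i,j\leq p^n}\in M_{p^n}(\mathbb{Z}_p)$ be defined by $a_{ij}=1$ if $j\equiv(i-1)(1+pu)^k+1\pmod{p^n}$ for some $0\leq k\leq d-1$, and $a_{ij}=0$ otherwise. Then $$\det A=\begin{cases}1& n=1,\\ d^{(p-1)(n-1)}& n\neq1,\ d<p,\\ 0& n\neq1,\ d\geq p.\end{cases}$$ *)

theory Defs
  imports "Berlekamp_Zassenhaus.Finite_Field" "Jordan_Normal_Form.Determinant"
begin

text \<open>
  The ring of \<open>p\<close>-adic integers, as the inverse limit of the rings of integers modulo \<open>p^m\<close>:
  an element is a compatible sequence of residues \<open>x m\<close> in \<open>{0..<p^m}\<close>, with ring operations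
  carried out componentwise.  The prime \<open>p\<close> is the cardinality of the type parameter, as for
  \<^typ>\<open>'p mod_ring\<close>.
\<close>

typedef (overloaded) ('p :: prime_card) padic_int =
  "{x :: nat \<Rightarrow> int.
     (\<forall>m. 0 \<le> x m \<and> x m < int CARD('p) ^ m) \<and>
     (\<forall>m. x (Suc m) mod int CARD('p) ^ m = x m)}"
  by (rule exI[of _ "\<lambda>_. 0"]) (simp add: prime_gt_0_nat prime_card)

setup_lifting type_definition_padic_int

lemma card_pos: "0 < int CARD('p :: prime_card) ^ m"
proof -
  have "prime CARD('p)" by (rule prime_card)
  then show ?thesis by (simp add: prime_gt_0_nat)
qed

lemma card_gt_1: "1 < CARD('p :: prime_card)"
  by (rule prime_gt_1_nat[OF prime_card])

lemma mod_compat: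
  "(a mod int CARD('p :: prime_card) ^ Suc m) mod int CARD('p) ^ m = a mod int CARD('p) ^ m"
  by (rule mod_mod_cancel) simp

instantiation padic_int :: (prime_card) comm_ring_1
begin

lift_definition zero_padic_int :: "'a padic_int" is "\<lambda>_. 0"
  using card_pos by simp

lift_definition one_padic_int :: "'a padic_int" is "\<lambda>m. 1 mod int CARD('a) ^ m"
  using card_pos mod_compat by (metis pos_mod_bound pos_mod_sign)

lift_definition plus_padic_int :: "'a padic_int \<Rightarrow> 'a padic_int \<Rightarrow> 'a padic_int"
  is "\<lambda>x y m. (x m + y m) mod int CARD('a) ^ m"
proof (intro conjI allI)
  fix x y :: "nat \<Rightarrow> int" and m
  assume "(\<forall>m. 0 \<le> x m \<and> x m < int CARD('a) ^ m) \<and>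
      (\<forall>m. x (Suc m) mod int CARD('a) ^ m = x m)"
    and "(\<forall>m. 0 \<le> y m \<and> y m < int CARD('a) ^ m) \<and>
      (\<forall>m. y (Suc m) mod int CARD('a) ^ m = y m)"
  then show "(x (Suc m) + y (Suc m)) mod int CARD('a) ^ Suc m mod int CARD('a) ^ m =
      (x m + y m) mod int CARD('a) ^ m"
    unfolding mod_compat by (metis mod_add_eq)
qed (simp_all add: card_pos)

lift_definition times_padic_int :: "'a padic_int \<Rightarrow> 'a padic_int \<Rightarrow> 'a padic_int"
  is "\<lambda>x y m. (x m * y m) mod int CARD('a) ^ m"
proof (intro conjI allI)
  fix x y :: "nat \<Rightarrow> int" and m
  assume "(\<forall>m. 0 \<le> x m \<and> x m < int CARD('a) ^ m) \<and>
      (\<forall>m. x (Suc m) mod int CARD('a) ^ m = x m)"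
    and "(\<forall>m. 0 \<le> y m \<and> y m < int CARD('a) ^ m) \<and>
      (\<forall>m. y (Suc m) mod int CARD('a) ^ m = y m)"
  then show "(x (Suc m) * y (Suc m)) mod int CARD('a) ^ Suc m mod int CARD('a) ^ m =
      (x m * y m) mod int CARD('a) ^ m"
    unfolding mod_compat by (metis mod_mult_eq)
qed (simp_all add: card_pos)

lift_definition uminus_padic_int :: "'a padic_int \<Rightarrow> 'a padic_int"
  is "\<lambda>x m. (- x m) mod int CARD('a) ^ m"
proof (intro conjI allI)
  fix x :: "nat \<Rightarrow> int" and m
  assume "(\<forall>m. 0 \<le> x m \<and> x m < int CARD('a) ^ m) \<and>
      (\<forall>m. x (Suc m) mod int CARD('a) ^ m = x m)"
  then show "(- x (Suc m)) mod int CARD('a) ^ Suc m mod int CARD('a) ^ m =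
      (- x m) mod int CARD('a) ^ m"
    unfolding mod_compat by (metis mod_minus_eq)
qed (simp_all add: card_pos)

definition minus_padic_int :: "'a padic_int \<Rightarrow> 'a padic_int \<Rightarrow> 'a padic_int"
  where "minus_padic_int x y = x + (- y)"

instance
proof
  fix a b c :: "'a padic_int"
  show "a * b * c = a * (b * c)"
    by transfer (simp add: mod_simps mult.assoc)
  show "a * b = b * a"
    by transfer (simp add: mult.commute)
  show "1 * a = a"
    by transfer (auto simp: mod_simps)
  show "(a + b) * c = a * c + b * c"
    by transfer (simp add: mod_simps distrib_right)
  show "a + b + c = a + (b + c)"
    by transfer (simp add: mod_simps add.assoc)
  show "a + b = b + a"
    by transfer (simp add: add.commute)
  show "0 + a = a"
    by transfer auto
  show "- a + a = 0"
    by transfer (simp add: mod_simps)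
  show "a - b = a + - b"
    by (rule minus_padic_int_def)
  show "(0 :: 'a padic_int) \<noteq> 1"
  proof transfer
    have "1 mod int CARD('a) ^ 1 = 1"
      using card_gt_1[where 'p = 'a] by simp
    then show "(\<lambda>_. 0) \<noteq> (\<lambda>m. 1 mod int CARD('a) ^ m)"
      by (auto dest!: fun_cong[of _ _ 1])
  qed
qed

end

lemma Rep_padic_int_of_int:
  "Rep_padic_int (of_int a :: 'p :: prime_card padic_int) m = a mod int CARD('p) ^ m"
proof -
  have nat: "Rep_padic_int (of_nat b :: 'p padic_int) m = int b mod int CARD('p) ^ m" for b
    by (induction b)
      (simp_all add: zero_padic_int.rep_eq plus_padic_int.rep_eq one_padic_int.rep_eq mod_simps)
  show ?thesis
    by (cases a rule: int_cases2)
      (simp_all add: nat uminus_padic_int.rep_eq mod_simps)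
qed

instance padic_int :: (prime_card) ring_char_0
proof
  show "inj (of_nat :: nat \<Rightarrow> 'a padic_int)"
  proof (rule injI)
    fix a b :: nat
    assume eq: "(of_nat a :: 'a padic_int) = of_nat b"
    define m where "m = a + b"
    have "m < CARD('a) ^ m"
      using card_gt_1[where 'p = 'a] by (intro power_gt_expt) simp
    then have lt: "int a < int CARD('a) ^ m" "int b < int CARD('a) ^ m"
      unfolding m_def by (simp_all flip: of_nat_power)
    have "int a mod int CARD('a) ^ m = int b mod int CARD('a) ^ m"
      using eq Rep_padic_int_of_int[of "int a" m, where 'p = 'a]
        Rep_padic_int_of_int[of "int b" m, where 'p = 'a] by simp
    with lt show "a = b" by simp
  qed
qed

text \<open>
  The entry \<open>a\<^sub>i\<^sub>j\<close>, with the one-based indices \<open>1 \<le> i, j \<le> p^n\<close>; the congruence is taken in the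
  integers because \<open>u\<close> may be negative.
\<close>

definition A_entry ::
    "nat \<Rightarrow> nat \<Rightarrow> nat \<Rightarrow> int \<Rightarrow> nat \<Rightarrow> nat \<Rightarrow> 'a :: zero_neq_one" where
  "A_entry p n d u i j =
     (if \<exists>k \<le> d - 1. [int j = (int i - 1) * (1 + int p * u) ^ k + 1] (mod int p ^ n)
      then 1 else 0)"

text \<open>Matrices in \<^theory>\<open>Jordan_Normal_Form.Matrix\<close> are indexed from zero, hence the shift.\<close>

definition A_mat :: "nat \<Rightarrow> nat \<Rightarrow> nat \<Rightarrow> int \<Rightarrow> 'a :: zero_neq_one mat" where
  "A_mat p n d u = mat (p ^ n) (p ^ n) (\<lambda>(r, c). A_entry p n d u (r + 1) (c + 1))"

end

theory Submission
  imports Defs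
begin

text \<open>
  With \<open>q = 1 + pu\<close>, the matrix encodes the first \<open>d\<close> steps of multiplication by \<open>q\<close> on
  \<open>\<int>/p^n\<close>.  If \<open>n \<ge> 2\<close> and \<open>d \<ge> p\<close>, the orbit of \<open>p^(n-2)\<close> has only \<open>p\<close> elements, so two of its
  rows coincide.  If \<open>p\<close> is odd and \<open>d < p\<close>, the multiples of \<open>p\<close> in \<open>\<int>/p^(n+1)\<close> form a copy of
  the matrix for \<open>n\<close>, while the units split into \<open>p - 1\<close> orbits of length \<open>p^n\<close> with
  representatives \<open>1, \<dots>, p - 1\<close>.  Each of these contributes a circulant matrix
  \<open>I + P + \<dots> + P^(d-1)\<close>, where \<open>P\<close> is a cyclic shift; its determinant is \<open>d\<close> for \<open>n \<ge> 1\<close> because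
  \<open>P\<close> and \<open>P^d\<close> are conjugate, so that \<open>det (I - xP)\<close> and \<open>det (I - x P^d)\<close> are the same polynomial
  \<open>1 - x^N\<close>, \<open>N = p^n\<close>.  The remaining case \<open>p = 2\<close>, \<open>d = 1\<close> is the identity matrix.
\<close>

section \<open>Determinants over finite index sets\<close>

text \<open>The Leibniz formula without an ordering of the indices, so that residues, units and
  pairs can serve as indices directly.\<close>

definition det_on :: "'i set \<Rightarrow> ('i \<Rightarrow> 'i \<Rightarrow> 'a) \<Rightarrow> 'a :: comm_ring_1" where
  "det_on S f = (\<Sum>\<pi> | \<pi> permutes S. of_int (sign \<pi>) * (\<Prod>i\<in>S. f i (\<pi> i)))"

lemma det_on_cong:
  assumes "\<And>i j. i \<in> S \<Longrightarrow> j \<in> S \<Longrightarrow> f i j = g i j"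
  shows "det_on S f = det_on S g"
  unfolding det_on_def
proof (intro sum.cong refl arg_cong2[where f = "(*)"] prod.cong)
  fix \<pi> i assume "\<pi> \<in> {\<pi>. \<pi> permutes S}" "i \<in> S"
  then show "f i (\<pi> i) = g i (\<pi> i)"
    by (intro assms) (simp_all add: permutes_in_image)
qed

lemma det_mat_eq_det_on: "det (mat n n (\<lambda>(i, j). f i j)) = det_on {0..<n} f"
proof -
  have "det (mat n n (\<lambda>(i, j). f i j)) =
      (\<Sum>\<pi> | \<pi> permutes {0..<n}. of_int (sign \<pi>) * (\<Prod>i = 0..<n. mat n n (\<lambda>(i, j). f i j) $$ (i, \<pi> i)))"
    by (rule det_def') simp
  also have "\<dots> = det_on {0..<n} (\<lambda>i j. mat n n (\<lambda>(i, j). f i j) $$ (i, j))"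
    by (simp add: det_on_def)
  also have "\<dots> = det_on {0..<n} f"
    by (rule det_on_cong) simp
  finally show ?thesis .
qed

text \<open>Conjugation by \<open>h\<close> carries permutations of \<open>S\<close> to permutations
  of \<open>T\<close> and preserves the sign, so the two Leibniz sums agree term by term.\<close>

lemma det_on_reindex:
  assumes h: "bij_betw h S T" and fin: "finite S"
  shows "det_on T f = det_on S (\<lambda>i j. f (h i) (h j))"
proof -
  have inj: "inj_on h S" and T: "h ` S = T"
    using h by (auto simp: bij_betw_def)
  have eq: "(if x \<in> T then h (\<pi> (inv_into S h x)) else x) = map_permutation S h \<pi> x" for \<pi> x
    by (simp add: map_permutation_def T restrict_id_def)
  have bij: "bij_betw (map_permutation S h) {\<pi>. \<pi> permutes S} {\<pi>. \<pi> permutes T}"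
    using bij_betw_permutations[OF h] unfolding eq .
  have "det_on T f =
      (\<Sum>\<pi> | \<pi> permutes S. of_int (sign (map_permutation S h \<pi>)) * (\<Prod>i\<in>T. f i (map_permutation S h \<pi> i)))"
    unfolding det_on_def by (rule sum.reindex_bij_betw[OF bij, symmetric])
  also have "\<dots> = det_on S (\<lambda>i j. f (h i) (h j))"
    unfolding det_on_def
  proof (intro sum.cong refl)
    fix \<pi> assume "\<pi> \<in> {\<pi>. \<pi> permutes S}"
    then have \<pi>: "\<pi> permutes S" by simp
    have "(\<Prod>i\<in>T. f i (map_permutation S h \<pi> i)) = (\<Prod>i\<in>S. f (h i) (map_permutation S h \<pi> (h i)))"
      by (rule prod.reindex_bij_betw[OF h, symmetric])
    also have "\<dots> = (\<Prod>i\<in>S. f (h i) (h (\<pi> i)))"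
      using map_permutation_apply[OF inj] by (intro prod.cong) simp_all
    finally show "of_int (sign (map_permutation S h \<pi>)) * (\<Prod>i\<in>T. f i (map_permutation S h \<pi> i)) =
        of_int (sign \<pi>) * (\<Prod>i\<in>S. f (h i) (h (\<pi> i)))"
      by (simp add: sign_map_permutation[OF inj \<pi> fin])
  qed
  finally show ?thesis .
qed

text \<open>Enumerating \<open>S\<close> before \<open>T\<close> makes the matrix block lower
  triangular.\<close>

lemma det_on_union:
  fixes f :: "'i \<Rightarrow> 'i \<Rightarrow> 'a :: idom"
  assumes fin: "finite S" "finite T" and disj: "S \<inter> T = {}"
    and zero: "\<And>i j. i \<in> S \<Longrightarrow> j \<in> T \<Longrightarrow> f i j = 0"
  shows "det_on (S \<union> T) f = det_on S f * det_on T f"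
proof -
  define a b where "a = card S" and "b = card T"
  obtain g where g: "bij_betw g {0..<a} S"
    using ex_bij_betw_nat_finite[OF fin(1)] unfolding a_def by blast
  obtain h where h: "bij_betw h {0..<b} T"
    using ex_bij_betw_nat_finite[OF fin(2)] unfolding b_def by blast
  define e where "e i = (if i < a then g i else h (i - a))" for i
  have e1: "bij_betw e {0..<a} S"
    using g by (rule bij_betw_cong[THEN iffD1, rotated]) (simp add: e_def)
  have "bij_betw (\<lambda>i. i - a) {a..<a+b} {0..<b}"
    by (rule bij_betw_byWitness[where f' = "\<lambda>i. i + a"]) auto
  then have "bij_betw (h \<circ> (\<lambda>i. i - a)) {a..<a+b} T"
    by (rule bij_betw_trans) (rule h)
  then have e2: "bij_betw e {a..<a+b} T"
    by (rule bij_betw_cong[THEN iffD1, rotated]) (simp add: e_def)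
  have e: "bij_betw e {0..<a+b} (S \<union> T)"
    using bij_betw_combine[OF e1 e2 disj] by (simp add: ivl_disj_un)
  let ?F = "\<lambda>i j. f (e i) (e j)"
  have inS: "e i \<in> S" if "i < a" for i
    using bij_betwE[OF e1] that by simp
  have inT: "e i \<in> T" if "a \<le> i" "i < a + b" for i
    using bij_betwE[OF e2] that by simp
  let ?A = "mat a a (\<lambda>(i, j). ?F i j)"
    and ?C = "mat b a (\<lambda>(i, j). ?F (i + a) j)"
    and ?D = "mat b b (\<lambda>(i, j). ?F (i + a) (j + a))"
  have "det_on (S \<union> T) f = det (mat (a + b) (a + b) (\<lambda>(i, j). ?F i j))"
    unfolding det_mat_eq_det_on using det_on_reindex[OF e, of f] by simp
  also have "mat (a + b) (a + b) (\<lambda>(i, j). ?F i j) = four_block_mat ?A (0\<^sub>m a b) ?C ?D"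
    by (rule eq_matI) (auto simp: four_block_mat_def Let_def intro!: zero inS inT)
  also have "det \<dots> = det ?A * det ?D"
    by (rule det_four_block_mat_upper_right_zero) (rule mat_carrier refl)+
  also have "det ?A = det_on S f"
    unfolding det_mat_eq_det_on using det_on_reindex[OF e1, of f] by simp
  also have "det ?D = det_on T f"
  proof -
    have "det_on T f = det_on {0..<b} (\<lambda>i j. f (h i) (h j))"
      using det_on_reindex[OF h, of f] by simp
    then show ?thesis
      unfolding det_mat_eq_det_on by (simp add: e_def)
  qed
  finally show ?thesis .
qed

lemma det_on_empty [simp]: "det_on {} f = 1"
  by (simp add: det_on_def)

lemma det_on_blocks:
  fixes f :: "'b \<Rightarrow> 'b \<Rightarrow> 'c :: idom"
  assumes "finite I" and fin: "finite K"
  shows "det_on (I \<times> K) (\<lambda>(a, k) (b, l). if a = b then f k l else 0) = det_on K f ^ card I"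
  using assms(1)
proof induction
  case empty
  show ?case by simp
next
  case (insert a I)
  let ?f = "\<lambda>(a :: 'a, k) (b, l). if a = b then f k l else 0"
  have "insert a I \<times> K = {a} \<times> K \<union> I \<times> K"
    by auto
  moreover have "det_on ({a} \<times> K \<union> I \<times> K) ?f = det_on ({a} \<times> K) ?f * det_on (I \<times> K) ?f"
    by (rule det_on_union) (use insert fin in auto)
  moreover have "det_on ({a} \<times> K) ?f = det_on K f"
  proof -
    have "bij_betw (Pair a) K ({a} \<times> K)"
      by (auto simp: bij_betw_def inj_on_def)
    from det_on_reindex[OF this fin, of ?f] show ?thesis
      by simp
  qed
  ultimately show ?case
    using insert by simp
qed

section \<open>Circulant matrices\<close>

text \<open>Laplace expansion along column \<open>0\<close>, whose only nonzero entries are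
  \<open>1\<close> in the first row and \<open>-x\<close> in the last. The two minors are
  triangular, with diagonal entries \<open>1\<close> and \<open>-x\<close> respectively.\<close>

lemma det_shift:
  fixes x :: "'a :: idom"
  assumes "N > 0"
  shows "det_on {0..<N} (\<lambda>i j. of_bool (i = j) - x * of_bool ((i + 1) mod N = j)) = 1 - x ^ N"
proof (cases "N = 1")
  case True
  then show ?thesis
    unfolding det_mat_eq_det_on[symmetric] by (subst det_single) auto
next
  case False
  \<comment> \<open>For \<open>N \<ge> 2\<close> the diagonal entry and the wrap-around entry of
    column \<open>0\<close> lie in different rows.\<close>
  with assms obtain M where N: "N = Suc (Suc M)"
    by (metis One_nat_def gr0_implies_Suc not0_implies_Suc)
  define A :: "'a mat" where
    "A = mat N N (\<lambda>(i, j). of_bool (i = j) - x * of_bool ((i + 1) mod N = j))"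
  have A: "A \<in> carrier_mat N N"
    by (simp add: A_def)
  have del: "mat_delete A i 0 = mat (Suc M) (Suc M) (\<lambda>(k, l). A $$ (if k < i then k else Suc k, Suc l))"
    if "i < N" for i
    using A by (simp add: mat_delete_def N)
  \<comment> \<open>Outside column \<open>0\<close> nothing wraps around, so the reduction modulo
    \<open>N\<close> disappears.\<close>
  have ent: "A $$ (i, Suc l) = of_bool (i = Suc l) - x * of_bool (i = l)"
    if "i < N" "l < Suc M" for i l
    using that by (auto simp: A_def N mod_Suc)
  have "det A = (\<Sum>i<N. A $$ (i, 0) * cofactor A i 0)"
    by (rule laplace_expansion_column[OF A]) (simp add: N)
  also have "\<dots> = (\<Sum>i\<in>{0, Suc M}. A $$ (i, 0) * cofactor A i 0)"
    by (rule sum.mono_neutral_right) (auto simp: A_def N mod_Suc split: if_splits)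
  also have "\<dots> = cofactor A 0 0 - x * cofactor A (Suc M) 0"
    by (simp add: A_def N)
  also have "cofactor A 0 0 = 1"
  proof -
    have "det (mat_delete A 0 0) = prod_list (diag_mat (mat_delete A 0 0))"
      by (rule det_upper_triangular[of _ "Suc M"]) (auto simp: del N ent)
    also have "\<dots> = 1"
      by (auto simp: prod_list_diag_prod del N ent)
    finally show ?thesis
      by (simp add: cofactor_def)
  qed
  also have "cofactor A (Suc M) 0 = x ^ Suc M"
  proof -
    have "det (mat_delete A (Suc M) 0) = prod_list (diag_mat (mat_delete A (Suc M) 0))"
      by (rule det_lower_triangular[of "Suc M"]) (auto simp: del N ent)
    also have "\<dots> = (- x) ^ Suc M"
      by (simp add: prod_list_diag_prod del N ent)
    finally show ?thesis
      by (simp add: cofactor_def power_mult_distrib[symmetric] del: power_Suc)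
  qed
  finally show ?thesis
    by (simp add: A_def det_mat_eq_det_on N)
qed

lemma bij_betw_mult_mod:
  fixes d N :: nat
  assumes "coprime d N" "N > 0"
  shows "bij_betw (\<lambda>i. (d * i) mod N) {0..<N} {0..<N}"
proof -
  have "inj_on (\<lambda>i. (d * i) mod N) {0..<N}"
  proof (rule inj_onI)
    fix i j assume ij: "i \<in> {0..<N}" "j \<in> {0..<N}" "(d * i) mod N = (d * j) mod N"
    then have "[d * i = d * j] (mod N)"
      by (simp add: cong_def)
    then have "[i = j] (mod N)"
      using cong_mult_lcancel_nat assms(1) by blast
    with ij show "i = j"
      by (simp add: cong_def)
  qed
  moreover have "(\<lambda>i. (d * i) mod N) ` {0..<N} \<subseteq> {0..<N}"
    using assms(2) by auto
  ultimately show ?thesis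
    by (simp add: bij_betw_def endo_inj_surj)
qed

lemma det_shift_by:
  fixes x :: "'a :: idom"
  assumes "coprime d N" "N > 0"
  shows "det_on {0..<N} (\<lambda>i j. of_bool (i = j) - x * of_bool ((i + d) mod N = j)) = 1 - x ^ N"
proof -
  \<comment> \<open>multiplication by \<open>d\<close> conjugates the shift by \<open>1\<close> into the shift by \<open>d\<close>\<close>
  let ?h = "\<lambda>i. (d * i) mod N"
  have bij: "bij_betw ?h {0..<N} {0..<N}"
    by (rule bij_betw_mult_mod) fact+
  have "((?h i + d) mod N = ?h j) = ((i + 1) mod N = j)" if "i < N" "j < N" for i j
  proof -
    have "(?h i + d) mod N = ?h ((i + 1) mod N)"
      by (simp add: mod_simps algebra_simps)
    moreover have "?h ((i + 1) mod N) = ?h j \<longleftrightarrow> (i + 1) mod N = j"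
      using that assms(2) by (intro inj_on_eq_iff[OF bij_betw_imp_inj_on[OF bij]]) simp_all
    ultimately show ?thesis
      by (simp only:)
  qed
  moreover have "(?h i = ?h j) = (i = j)" if "i < N" "j < N" for i j
    using that by (intro inj_on_eq_iff[OF bij_betw_imp_inj_on[OF bij]]) simp_all
  ultimately have "det_on {0..<N} (\<lambda>i j. of_bool (i = j) - x * of_bool ((i + d) mod N = j)) =
      det_on {0..<N} (\<lambda>i j. of_bool (i = j) - x * of_bool ((i + 1) mod N = j))"
    by (subst det_on_reindex[OF bij]) (auto intro!: det_on_cong)
  then show ?thesis
    using det_shift[OF assms(2)] by simp
qed

text \<open>For the cyclic shift \<open>P\<close>, the product of \<open>I - x P\<close> and the sum
  of \<open>x^k P^k\<close> over \<open>k < d\<close> telescopes to \<open>I - x^d P^d\<close>.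
  Taking determinants, \<open>det_shift\<close> evaluates the first factor, and
  \<open>det_shift_by\<close> with \<open>x^d\<close> in place of \<open>x\<close> the right-hand
  side.\<close>

lemma det_geometric_shift:
  fixes x :: "'a :: idom"
  assumes "coprime d N" "N > 0"
  shows "(1 - x ^ N) * det_on {0..<N} (\<lambda>i j. \<Sum>k<d. x ^ k * of_bool ((i + k) mod N = j)) =
    1 - (x ^ N) ^ d"
proof -
  let ?P = "mat N N (\<lambda>(i, j). of_bool (i = j) - x * of_bool ((i + 1) mod N = j))"
    and ?S = "mat N N (\<lambda>(i, j). \<Sum>k<d. x ^ k * of_bool ((i + k) mod N = j))"
    and ?R = "mat N N (\<lambda>(i, j). of_bool (i = j) - x ^ d * of_bool ((i + d) mod N = j))"
  have "?P * ?S = ?R"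
  proof (rule eq_matI)
    fix i j assume "i < dim_row ?R" "j < dim_col ?R"
    then have ij: "i < N" "j < N"
      by simp_all
    define s where "s l = (\<Sum>k<d. x ^ k * of_bool ((l + k) mod N = j))" for l
    have "(?P * ?S) $$ (i, j) = (\<Sum>l = 0..<N. (of_bool (i = l) - x * of_bool ((i + 1) mod N = l)) * s l)"
      using ij by (simp add: scalar_prod_def s_def)
    also have "\<dots> = (\<Sum>l = 0..<N. if i = l then s l else 0) - x * (\<Sum>l = 0..<N. if (i + 1) mod N = l then s l else 0)"
      unfolding sum_distrib_left sum_subtractf[symmetric]
      by (intro sum.cong) (auto simp: algebra_simps)
    also have "\<dots> = s i - x * s ((i + 1) mod N)"
      using ij by simp
    also have "x * s ((i + 1) mod N) = (\<Sum>k<d. x ^ Suc k * of_bool ((i + Suc k) mod N = j))"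
      unfolding s_def sum_distrib_left by (intro sum.cong) (simp_all add: mod_simps)
    also have "s i - \<dots> = of_bool (i mod N = j) - x ^ d * of_bool ((i + d) mod N = j)"
      unfolding s_def sum_subtractf[symmetric]
      using sum_lessThan_telescope'[of "\<lambda>k. x ^ k * of_bool ((i + k) mod N = j)" d] by simp
    finally show "(?P * ?S) $$ (i, j) = ?R $$ (i, j)"
      using ij by simp
  qed simp_all
  then have "det ?P * det ?S = det ?R"
    using det_mult[of ?P N ?S] by simp
  then show ?thesis
    unfolding det_mat_eq_det_on det_shift[OF assms(2)] det_shift_by[OF assms]
    by (simp add: power_mult[symmetric] mult.commute)
qed

lemma det_circulant:
  assumes "coprime d N" "N > 0"
  shows "det_on {0..<N} (\<lambda>i j. \<Sum>k<d. of_bool ((i + k) mod N = j)) = (int d)"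
proof -
  \<comment> \<open>an indeterminate, since \<open>1 - x ^ N\<close> has to be cancelled before setting \<open>x = 1\<close>\<close>
  define x where "x = [:0, 1 :: int:]"
  define D where "D = det_on {0..<N} (\<lambda>i j. \<Sum>k<d. x ^ k * of_bool ((i + k) mod N = j))"
  have "(1 - x ^ N) * D = (1 - x ^ N) * (\<Sum>k<d. (x ^ N) ^ k)"
    unfolding D_def det_geometric_shift[OF assms] by (rule one_diff_power_eq)
  moreover have "1 - x ^ N \<noteq> 0"
  proof
    assume "1 - x ^ N = 0"
    then have "poly (1 - x ^ N) 0 = 0" by simp
    then show False
      using assms(2) by (simp add: x_def power_0_left)
  qed
  ultimately have "D = (\<Sum>k<d. (x ^ N) ^ k)"
    by simp
  then have "poly D 1 = int d"
    by (simp add: x_def poly_sum)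
  moreover have "poly D 1 = det_on {0..<N} (\<lambda>i j. \<Sum>k<d. of_bool ((i + k) mod N = j))"
    unfolding D_def det_on_def
    by (auto simp: poly_sum poly_prod x_def sign_def intro!: sum.cong prod.cong)
  ultimately show ?thesis
    by simp
qed

section \<open>Powers of \<open>1 + pu\<close> modulo powers of \<open>p\<close>\<close>

text \<open>The binomial expansion through second order. The quadratic coefficient stays explicit
  because \<open>power_one_plus_prime\<close> uses that an odd \<open>p\<close> divides it for
  \<open>m = p\<close>.\<close>

lemma one_plus_power_expansion:
  fixes t :: "'a :: comm_ring_1"
  shows "\<exists>z. (1 + t) ^ m = 1 + of_nat m * t + of_nat (m choose 2) * t ^ 2 + t ^ 3 * z"
proof (induction m)
  case 0
  show ?case by (rule exI[of _ 0]) (simp add: binomial_eq_0)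
next
  case (Suc m)
  then obtain z where z: "(1 + t) ^ m = 1 + of_nat m * t + of_nat (m choose 2) * t ^ 2 + t ^ 3 * z"
    by blast
  have c: "Suc m choose 2 = m + (m choose 2)"
    by (simp add: numeral_2_eq_2)
  have "(1 + t) ^ Suc m = 1 + of_nat (Suc m) * t + of_nat (Suc m choose 2) * t ^ 2
      + t ^ 3 * (of_nat (m choose 2) + z + t * z)"
    unfolding power_Suc z c by (simp add: algebra_simps power2_eq_square power3_eq_cube)
  then show ?case by blast
qed

text \<open>The linear term \<open>p * p^s * w\<close> is divisible by \<open>p\<close> exactly
  \<open>s + 1\<close> times. The quadratic term is divisible by \<open>p^(2s+1)\<close>, as
  \<open>p\<close> is odd, and the cubic remainder by \<open>p^(3s)\<close>; both exponents are at
  least \<open>s + 2\<close>.\<close>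

lemma power_one_plus_prime:
  fixes p :: nat and w :: int
  assumes p: "prime p" "odd p" and w: "\<not> int p dvd w" and s: "s \<ge> 1"
  shows "\<exists>w'. (1 + int p ^ s * w) ^ p = 1 + int p ^ Suc s * w' \<and> \<not> int p dvd w'"
proof -
  obtain z where z: "(1 + int p ^ s * w) ^ p =
      1 + of_nat p * (int p ^ s * w) + of_nat (p choose 2) * (int p ^ s * w) ^ 2 + (int p ^ s * w) ^ 3 * z"
    using one_plus_power_expansion by blast
  have "p dvd p choose 2"
    using p prime_ge_2_nat[OF p(1)] by (intro dvd_choose_prime) (auto simp: le_less)
  then obtain c where c: "p choose 2 = p * c"
    by blast
  obtain r where r: "s = Suc r"
    using s by (cases s) auto
  have "(1 + int p ^ s * w) ^ p = 1 + int p ^ Suc s * (w + int p * (int p ^ r * int c * w ^ 2 + int p ^ r * int p ^ r * w ^ 3 * z))"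
    unfolding z c by (simp add: r algebra_simps power2_eq_square power3_eq_cube)
  moreover have "\<not> int p dvd w + int p * (int p ^ r * int c * w ^ 2 + int p ^ r * int p ^ r * w ^ 3 * z)"
    using w by (simp add: dvd_add_left_iff)
  ultimately show ?thesis by blast
qed

text \<open>Lifting the exponent. Divisibility by \<open>p^(s+1)\<close> already forces
  \<open>p dvd m\<close> through the linear term. The \<open>p\<close>-th power of the base then has
  the same shape at level \<open>s + 1\<close>, so the induction must generalise \<open>s\<close>
  and \<open>w\<close>.\<close>

lemma prime_power_dvd_one_plus_power_minus_one:
  fixes p :: nat and w :: int
  assumes p: "prime p" "odd p" and "\<not> int p dvd w" and "s \<ge> 1"
  shows "int p ^ (n + s) dvd (1 + int p ^ s * w) ^ m - 1 \<longleftrightarrow> p ^ n dvd m"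
  using assms(3,4)
proof (induction n arbitrary: s w m)
  case 0
  have "int p ^ s dvd (1 + int p ^ s * w) ^ m - 1"
    unfolding power_diff_1_eq by simp
  then show ?case by simp
next
  case (Suc n)
  let ?t = "int p ^ s * w"
  have p0: "p > 0"
    using p(1) by (rule prime_gt_0_nat)
  have "p dvd m" if dvd: "int p ^ (Suc n + s) dvd (1 + ?t) ^ m - 1"
  proof -
    obtain z where z: "(1 + ?t) ^ m = 1 + of_nat m * ?t + of_nat (m choose 2) * ?t ^ 2 + ?t ^ 3 * z"
      using one_plus_power_expansion by blast
    obtain r where r: "s = Suc r"
      using Suc.prems by (cases s) auto
    have "(1 + ?t) ^ m - 1 = int p ^ s * (int m * w + int p * (int p ^ r * w ^ 2 * of_nat (m choose 2) + int p ^ r * ?t * w ^ 2 * z))"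
      unfolding z by (simp add: r algebra_simps power2_eq_square power3_eq_cube)
    moreover have "int p ^ s * int p dvd (1 + ?t) ^ m - 1"
      by (rule dvd_trans[OF _ dvd]) (simp add: power_add)
    ultimately have "int p dvd int m * w + int p * (int p ^ r * w ^ 2 * of_nat (m choose 2) + int p ^ r * ?t * w ^ 2 * z)"
      using p0 by simp
    then have "int p dvd int m * w"
      by (simp add: dvd_add_left_iff)
    then show ?thesis
      using Suc.prems p(1) by (simp add: prime_dvd_mult_iff)
  qed
  moreover have "p dvd m" if "p ^ Suc n dvd m"
    using that by (simp add: dvd_mult_left)
  moreover have "int p ^ (Suc n + s) dvd (1 + ?t) ^ m - 1 \<longleftrightarrow> p ^ Suc n dvd m" if "p dvd m"
  proof -
    obtain m' where m': "m = p * m'"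
      using \<open>p dvd m\<close> by blast
    obtain w' where w': "(1 + ?t) ^ p = 1 + int p ^ Suc s * w'" "\<not> int p dvd w'"
      using power_one_plus_prime[OF p Suc.prems] by blast
    have "(1 + ?t) ^ m = (1 + int p ^ Suc s * w') ^ m'"
      by (simp add: m' power_mult w'(1))
    then show ?thesis
      using Suc.IH[of w' "Suc s" m'] w'(2) p0 by (simp add: m')
  qed
  ultimately show ?case by blast
qed

section \<open>The determinant of \<open>A\<close>\<close>

text \<open>Rows and columns are the residues themselves. The base \<open>q\<close> is independent
  of \<open>N\<close> because the recursion shrinks the modulus while keeping
  \<open>q\<close>.\<close>

definition entry :: "int \<Rightarrow> int \<Rightarrow> nat \<Rightarrow> int \<Rightarrow> int \<Rightarrow> int" where
  "entry N q d x y = of_bool (\<exists>k<d. [y = x * q ^ k] (mod N))"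

text \<open>All entries are \<open>0\<close> or \<open>1\<close>, so the determinant can be computed
  over the integers; the one-based shift cancels in the congruence.\<close>

lemma det_A_mat:
  assumes "d \<ge> 1" "p > 0"
  shows "det (A_mat p n d u :: 'a :: comm_ring_1 mat) =
    of_int (det_on {0..<int p ^ n} (entry (int p ^ n) (1 + int p * u) d))"
proof -
  let ?e = "entry (int p ^ n) (1 + int p * u) d"
  have "A_entry p n d u (r + 1) (c + 1) = (of_int (?e (int r) (int c)) :: 'a)" for r c
  proof -
    have "[int (c + 1) = (int (r + 1) - 1) * (1 + int p * u) ^ k + 1] (mod int p ^ n) \<longleftrightarrow>
        [int c = int r * (1 + int p * u) ^ k] (mod int p ^ n)" for k
      by (simp add: cong_iff_dvd_diff)
    moreover have "k \<le> d - 1 \<longleftrightarrow> k < d" for k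
      using assms(1) by auto
    ultimately show ?thesis
      by (simp add: A_entry_def entry_def)
  qed
  then have "(A_mat p n d u :: 'a mat) =
      map_mat of_int (mat (p ^ n) (p ^ n) (\<lambda>(r, c). ?e (int r) (int c)))"
    unfolding A_mat_def by (intro eq_matI) simp_all
  then have "det (A_mat p n d u :: 'a mat) =
      of_int (det_on {0..<p ^ n} (\<lambda>r c. ?e (int r) (int c)))"
    by (simp add: det_mat_eq_det_on)
  moreover have "bij_betw int {0..<p ^ n} {0..<int p ^ n}"
    using image_int_atLeastLessThan[of 0 "p ^ n"] by (simp add: bij_betw_def)
  ultimately show ?thesis
    using det_on_reindex[of int "{0..<p ^ n}" "{0..<int p ^ n}" ?e] by simp
qed

lemma det_on_identity:
  assumes "finite S" "\<And>i j. i \<in> S \<Longrightarrow> j \<in> S \<Longrightarrow> f i j = of_bool (i = j)"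
  shows "det_on S f = 1"
proof -
  obtain g where g: "bij_betw g {0..<card S} S"
    using ex_bij_betw_nat_finite[OF assms(1)] by blast
  have "g i = g j \<longleftrightarrow> i = j" if "i < card S" "j < card S" for i j
    using that bij_betw_imp_inj_on[OF g] by (auto simp: inj_on_def)
  moreover have "g i \<in> S" if "i < card S" for i
    using bij_betwE[OF g] that by simp
  ultimately have "mat (card S) (card S) (\<lambda>(i, j). f (g i) (g j)) = 1\<^sub>m (card S)"
    using assms(2) by (intro eq_matI) auto
  then show ?thesis
    using det_on_reindex[OF g, of f] by (simp flip: det_mat_eq_det_on)
qed

text \<open>Serves the case \<open>n = 1\<close>, where \<open>1 + pu\<close> is \<open>1\<close>
  modulo \<open>p\<close> and every orbit is a single point.\<close>

lemma entry_identity: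
  assumes "[q = 1] (mod N)" "d \<ge> 1" "x \<in> {0..<N}" "y \<in> {0..<N}"
  shows "entry N q d x y = of_bool (x = y)"
proof -
  have "[x * q ^ k = x] (mod N)" for k
    using cong_mult[OF cong_refl[of x] cong_pow[OF assms(1), of k]] by simp
  then have "[y = x * q ^ k] (mod N) \<longleftrightarrow> [y = x] (mod N)" for k
    using cong_trans cong_sym by blast
  moreover have "[y = x] (mod N) \<longleftrightarrow> x = y"
    using assms(3,4) by (auto simp: cong_def)
  ultimately show ?thesis
    using assms(2) by (auto simp: entry_def intro!: exI[of _ 0])
qed

section \<open>Orbits of the units under multiplication by \<open>1 + pu\<close>\<close>

text \<open>The unit \<open>q = 1 + pu\<close> has order exactly \<open>p^n\<close> modulo
  \<open>p^(n+1)\<close>: cancelling the smaller power leaves \<open>q^m - 1\<close>, to which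
  lifting the exponent applies with \<open>s = 1\<close>.\<close>

lemma power_cong_power_iff:
  fixes p :: nat and u :: int
  assumes p: "prime p" "odd p" and u: "\<not> int p dvd u"
  shows "[(1 + int p * u) ^ k = (1 + int p * u) ^ l] (mod int p ^ Suc n) \<longleftrightarrow> [k = l] (mod p ^ n)"
proof (induction k l rule: linorder_wlog)
  case (le k l)
  let ?q = "1 + int p * u"
  have "coprime ?q (int p)"
  proof (rule coprimeI)
    fix c assume "c dvd ?q" "c dvd int p"
    then have "c dvd ?q - int p * u"
      by (intro dvd_diff dvd_mult2)
    then show "is_unit c" by simp
  qed
  then have cop: "coprime (?q ^ k) (int p ^ Suc n)"
    by simp
  obtain m where l: "l = k + m"
    using le by (auto simp: le_iff_add)
  have "[?q ^ k = ?q ^ l] (mod int p ^ Suc n) \<longleftrightarrow> [?q ^ k * 1 = ?q ^ k * ?q ^ m] (mod int p ^ Suc n)"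
    by (simp add: l power_add)
  also have "\<dots> \<longleftrightarrow> [?q ^ m = 1] (mod int p ^ Suc n)"
    using cong_mult_lcancel[OF cop] by (simp only: cong_sym_eq)
  also have "\<dots> \<longleftrightarrow> p ^ n dvd m"
    using prime_power_dvd_one_plus_power_minus_one[OF p u, of 1 n m] by (simp add: cong_iff_dvd_diff)
  also have "\<dots> \<longleftrightarrow> [l = k] (mod p ^ n)"
    by (simp add: cong_altdef_nat l)
  finally show ?case
    by (simp only: cong_sym_eq)
next
  case (sym k l)
  then show ?case
    by (simp only: cong_sym_eq)
qed

text \<open>Since \<open>1 + pu\<close> is \<open>1\<close> modulo \<open>p\<close>, reduction
  modulo \<open>p\<close> recovers \<open>a\<close> and \<open>b\<close>. Once they agree, they
  cancel as units.\<close>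

lemma coset_cong_iff:
  fixes p :: nat and u :: int
  assumes p: "prime p" "odd p" and u: "\<not> int p dvd u"
    and a: "a \<in> {1..<p}" and b: "b \<in> {1..<p}"
  shows "[int a * (1 + int p * u) ^ k = int b * (1 + int p * u) ^ l] (mod int p ^ Suc n) \<longleftrightarrow>
    a = b \<and> [k = l] (mod p ^ n)"
proof -
  let ?q = "1 + int p * u"
  have q: "[int c * ?q ^ m = int c] (mod int p)" for c m
  proof -
    have "[?q = 1] (mod int p)"
      by (simp add: cong_iff_dvd_diff)
    from cong_mult[OF cong_refl[of "int c"] cong_pow[OF this, of m]] show ?thesis
      by simp
  qed
  have "a = b" if "[int a * ?q ^ k = int b * ?q ^ l] (mod int p ^ Suc n)"
  proof -
    from that have "[int a * ?q ^ k = int b * ?q ^ l] (mod int p)"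
      by (rule cong_dvd_modulus) simp
    from cong_trans[OF cong_trans[OF cong_sym[OF q] this] q] have "[int a = int b] (mod int p)" .
    then show ?thesis
      using a b by (simp add: cong_def)
  qed
  moreover have "[int a * ?q ^ k = int b * ?q ^ l] (mod int p ^ Suc n) \<longleftrightarrow> [k = l] (mod p ^ n)" if "a = b"
  proof -
    have "\<not> p dvd a"
      using a by (auto dest: dvd_imp_le)
    with p(1) have "coprime p a"
      by (rule prime_imp_coprime)
    then have "coprime (int a) (int p)"
      by (simp add: coprime_commute)
    then have "coprime (int a) (int p ^ Suc n)"
      by (simp only: coprime_power_right_iff simp_thms)
    from cong_mult_lcancel[OF this] show ?thesis
      by (simp only: power_cong_power_iff[OF p u] that)
  qed
  ultimately show ?thesis
    by argo
qed

lemma multiples_below_power: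
  assumes "p > 0"
  shows "bij_betw ((*) (int p)) {0..<int p ^ n} {x \<in> {0..<int p ^ Suc n}. int p dvd x}"
  unfolding bij_betw_def
proof
  show "inj_on ((*) (int p)) {0..<int p ^ n}"
    using assms by (simp add: inj_on_def)
  show "(*) (int p) ` {0..<int p ^ n} = {x \<in> {0..<int p ^ Suc n}. int p dvd x}"
  proof (intro equalityI subsetI)
    fix x assume x: "x \<in> {x \<in> {0..<int p ^ Suc n}. int p dvd x}"
    then obtain y where y: "x = int p * y"
      by blast
    with x assms have "y \<in> {0..<int p ^ n}"
      by (auto simp: zero_le_mult_iff)
    with y show "x \<in> (*) (int p) ` {0..<int p ^ n}"
      by blast
  qed (use assms in auto)
qed

text \<open>Injectivity is \<open>coset_cong_iff\<close>. Surjectivity follows by counting: removing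
  the \<open>p^n\<close> multiples of \<open>p\<close> from \<open>p^(n+1)\<close> residues leaves
  \<open>(p - 1) * p^n\<close>.\<close>

lemma bij_betw_units:
  fixes p :: nat and u :: int
  assumes p: "prime p" "odd p" and u: "\<not> int p dvd u"
  shows "bij_betw (\<lambda>(a, k). (int a * (1 + int p * u) ^ k) mod int p ^ Suc n)
    ({1..<p} \<times> {0..<p ^ n}) {x \<in> {0..<int p ^ Suc n}. \<not> int p dvd x}"
    (is "bij_betw ?h ?S ?U")
proof -
  have p1: "p > 1"
    using p(1) by (rule prime_gt_1_nat)
  then have p0: "p > 0"
    by simp
  have fin: "finite {x \<in> {0..<int p ^ Suc n}. P x}" for P
    by (rule finite_subset[OF _ finite_atLeastLessThan_int]) (rule Collect_subset)
  have inj: "inj_on ?h ?S"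
  proof (rule inj_onI, clarify)
    fix a k b l
    assume *: "a \<in> {1..<p}" "b \<in> {1..<p}" "k \<in> {0..<p ^ n}" "l \<in> {0..<p ^ n}"
      "(int a * (1 + int p * u) ^ k) mod int p ^ Suc n = (int b * (1 + int p * u) ^ l) mod int p ^ Suc n"
    then have "a = b \<and> [k = l] (mod p ^ n)"
      using coset_cong_iff[OF p u *(1,2)] unfolding cong_def by blast
    with * show "a = b \<and> k = l"
      by (simp add: cong_def)
  qed
  moreover have "?h ` ?S \<subseteq> ?U"
  proof (rule image_subsetI)
    fix z assume "z \<in> ?S"
    then obtain a k where z: "z = (a, k)" and ak: "a \<in> {1..<p}" "k \<in> {0..<p ^ n}"
      by blast
    have "\<not> int p dvd 1 + int p * u"
      using p1 by (simp add: dvd_add_left_iff)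
    moreover have "\<not> p dvd a"
      using ak by (auto dest: dvd_imp_le)
    ultimately have "\<not> int p dvd int a * (1 + int p * u) ^ k"
      using p(1) by (metis int_dvd_int_iff prime_dvd_mult_iff prime_dvd_power prime_nat_int_transfer)
    then show "?h z \<in> ?U"
      using p0 by (simp add: z dvd_mod_iff)
  qed
  moreover have "card ?U = card ?S"
  proof -
    let ?M = "{x \<in> {0..<int p ^ Suc n}. int p dvd x}"
    have "card {0..<int p ^ Suc n} = card (?U \<union> ?M)"
      by (rule arg_cong[of _ _ card]) auto
    also have "\<dots> = card ?U + card ?M"
      by (rule card_Un_disjoint) (rule fin | simp add: disjoint_iff)+
    also have "card ?M = p ^ n"
      using bij_betw_same_card[OF multiples_below_power[OF p0, of n]]
      by (simp flip: of_nat_power)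
    finally have "card ?U + p ^ n = p ^ Suc n"
      by (simp add: nat_power_eq nat_mult_distrib)
    then show ?thesis
      by (simp add: diff_mult_distrib)
  qed
  ultimately have "?h ` ?S = ?U"
    by (intro card_subset_eq[OF fin]) (simp_all only: card_image)
  with inj show ?thesis
    unfolding bij_betw_def ..
qed

text \<open>At most \<open>N\<close> consecutive numbers are distinct modulo \<open>N\<close>, so
  the witness \<open>j\<close> is unique. This turns the 0-1 entries into the sums of
  \<open>det_circulant\<close>.\<close>

lemma of_bool_shift_eq_sum:
  fixes d N :: nat
  assumes "d \<le> N"
  shows "of_bool (\<exists>j<d. (k + j) mod N = l) = (\<Sum>j<d. of_bool ((k + j) mod N = l) :: int)"
proof (cases "\<exists>j<d. (k + j) mod N = l")
  case True
  then obtain j where j: "j < d" "(k + j) mod N = l"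
    by blast
  have unique: "i = j" if "i < d" "(k + i) mod N = l" for i
  proof -
    have "[k + i = k + j] (mod N)"
      unfolding cong_def that(2) j(2) ..
    then have "[i = j] (mod N)"
      unfolding cong_add_lcancel_nat .
    moreover have "i < N" "j < N"
      using that(1) j(1) assms by linarith+
    ultimately show ?thesis
      unfolding cong_def by (simp only: mod_less)
  qed
  have "{..<d} \<inter> {i. (k + i) mod N = l} = {j}"
    using j unique by blast
  then have "(\<Sum>j<d. of_bool ((k + j) mod N = l)) = (1 :: int)"
    by (simp only: sum_of_bool_eq finite_lessThan) simp
  then show ?thesis
    using True by simp
next
  case False
  then show ?thesis
    by auto
qed

section \<open>The recursion in \<open>n\<close> for odd \<open>p\<close> and
  \<open>d < p\<close>\<close>

text \<open>Multiplication by \<open>1 + pu\<close> keeps units among units, so the block from units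
  to multiples of \<open>p\<close> vanishes.\<close>

lemma entry_unit_multiple:
  fixes p :: nat
  assumes p: "prime p" and x: "\<not> int p dvd x" and y: "int p dvd y"
  shows "entry (int p ^ Suc n) (1 + int p * u) d x y = 0"
proof -
  have pi: "prime (int p)"
    using p by simp
  have q: "\<not> int p dvd 1 + int p * u"
    using prime_gt_1_nat[OF p] by (simp add: dvd_add_left_iff)
  have "\<not> [y = x * (1 + int p * u) ^ k] (mod int p ^ Suc n)" for k
  proof
    assume "[y = x * (1 + int p * u) ^ k] (mod int p ^ Suc n)"
    then have "[y = x * (1 + int p * u) ^ k] (mod int p)"
      by (rule cong_dvd_modulus) simp
    from cong_dvd_iff[OF this] y have "int p dvd x * (1 + int p * u) ^ k"
      by simp
    then show False
      using x q prime_dvd_power[OF pi] unfolding prime_dvd_mult_iff[OF pi] by blast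
  qed
  then show ?thesis
    unfolding entry_def by simp
qed

text \<open>Dividing both indices and the modulus by \<open>p\<close> preserves the congruence, with
  the same \<open>q\<close>.\<close>

lemma det_entry_multiples:
  fixes p :: nat
  assumes "p > 0"
  shows "det_on {x \<in> {0..<int p ^ Suc n}. int p dvd x} (entry (int p ^ Suc n) q d) =
    det_on {0..<int p ^ n} (entry (int p ^ n) q d)"
proof -
  have "entry (int p ^ Suc n) q d (int p * x) (int p * y) = entry (int p ^ n) q d x y" for x y
  proof -
    have "int p * y - int p * x * q ^ k = int p * (y - x * q ^ k)" for k
      by (simp add: algebra_simps)
    then have "[int p * y = int p * x * q ^ k] (mod int p ^ Suc n) \<longleftrightarrow> [y = x * q ^ k] (mod int p ^ n)" for k
      unfolding cong_iff_dvd_diff using assms by simp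
    then show ?thesis
      unfolding entry_def by simp
  qed
  then show ?thesis
    using det_on_reindex[OF multiples_below_power[OF assms, of n], of "entry (int p ^ Suc n) q d"]
    by simp
qed

text \<open>In the coordinates \<open>(a, k)\<close> of \<open>a * q^k\<close>, multiplication by
  \<open>q\<close> fixes \<open>a\<close> and shifts \<open>k\<close> cyclically, which gives
  \<open>p - 1\<close> equal diagonal blocks.\<close>

lemma det_entry_units:
  fixes p :: nat and u :: int
  assumes p: "prime p" "odd p" and u: "\<not> int p dvd u"
  shows "det_on {x \<in> {0..<int p ^ Suc n}. \<not> int p dvd x} (entry (int p ^ Suc n) (1 + int p * u) d) =
    det_on {0..<p ^ n} (\<lambda>k l. of_bool (\<exists>j<d. (k + j) mod p ^ n = l)) ^ (p - 1)"
proof -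
  let ?q = "1 + int p * u"
  let ?h = "\<lambda>(a, k). (int a * ?q ^ k) mod int p ^ Suc n"
    and ?E = "entry (int p ^ Suc n) ?q d"
  define g where "g k l = (of_bool (\<exists>j<d. (k + j) mod p ^ n = l) :: int)" for k l
  have block: "?E (?h (a, k)) (?h (b, l)) = (if a = b then g k l else 0)"
    if *: "a \<in> {1..<p}" "b \<in> {1..<p}" "l < p ^ n" for a k b l
  proof -
    have "[?h (b, l) = ?h (a, k) * ?q ^ j] (mod int p ^ Suc n) \<longleftrightarrow>
        a = b \<and> (k + j) mod p ^ n = l" for j
    proof -
      have "[?h (b, l) = ?h (a, k) * ?q ^ j] (mod int p ^ Suc n) \<longleftrightarrow>
          [int b * ?q ^ l = int a * ?q ^ (k + j)] (mod int p ^ Suc n)"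
        unfolding cong_def prod.case mod_mod_trivial mod_mult_left_eq power_add mult.assoc ..
      also have "\<dots> \<longleftrightarrow> b = a \<and> [l = k + j] (mod p ^ n)"
        by (rule coset_cong_iff[OF p u *(2,1)])
      finally show ?thesis
        unfolding cong_def mod_less[OF *(3)] by (simp only: eq_commute)
    qed
    then show ?thesis
      unfolding entry_def g_def by (cases "a = b") (simp_all only: simp_thms if_True if_False of_bool_eq)
  qed
  have "det_on {x \<in> {0..<int p ^ Suc n}. \<not> int p dvd x} ?E =
      det_on ({1..<p} \<times> {0..<p ^ n}) (\<lambda>i j. ?E (?h i) (?h j))"
    by (rule det_on_reindex[OF bij_betw_units[OF p u]]) simp
  also have "\<dots> = det_on ({1..<p} \<times> {0..<p ^ n}) (\<lambda>(a, k) (b, l). if a = b then g k l else 0)"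
  proof (rule det_on_cong)
    fix i j assume "i \<in> {1..<p} \<times> {0..<p ^ n}" "j \<in> {1..<p} \<times> {0..<p ^ n}"
    then obtain a k b l where "i = (a, k)" "j = (b, l)" "a \<in> {1..<p}" "b \<in> {1..<p}" "l < p ^ n"
      by auto
    with block show "?E (?h i) (?h j) = (\<lambda>(a, k) (b, l). if a = b then g k l else 0) i j"
      by (simp only: prod.case)
  qed
  also have "\<dots> = det_on {0..<p ^ n} g ^ card {1..<p}"
    by (rule det_on_blocks) simp_all
  finally show ?thesis
    unfolding g_def card_atLeastLessThan .
qed

text \<open>For \<open>n = 0\<close> the block is a single entry, equal to \<open>1\<close> because
  the existential ignores multiplicity; the sum in \<open>det_circulant\<close> would count
  \<open>d\<close>. For \<open>n \<ge> 1\<close>, \<open>d < p\<close> ensures both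
  \<open>d \<le> p^n\<close> and coprimality.\<close>

lemma det_cyclic_block:
  fixes p :: nat
  assumes p: "prime p" and d: "1 \<le> d" "d < p"
  shows "det_on {0..<p ^ n} (\<lambda>k l. of_bool (\<exists>j<d. (k + j) mod p ^ n = l)) =
    (if n = 0 then 1 else int d)"
proof (cases "n = 0")
  case True
  have "det_on {0..<p ^ n} (\<lambda>k l. of_bool (\<exists>j<d. (k + j) mod p ^ n = l)) = (1 :: int)"
    by (rule det_on_identity) (use True d(1) in \<open>auto intro!: exI[of _ 0]\<close>)
  then show ?thesis
    using True by simp
next
  case False
  have p0: "p > 0"
    using p by (rule prime_gt_0_nat)
  have "p ^ 1 \<le> p ^ n"
    by (rule power_increasing) (use False p0 in simp_all)
  then have "d \<le> p ^ n"
    using d(2) by simp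
  have "\<not> p dvd d"
    using d by (auto dest: dvd_imp_le)
  with p have "coprime p d"
    by (rule prime_imp_coprime)
  then have "coprime d (p ^ n)"
    by (simp add: coprime_commute)
  with \<open>d \<le> p ^ n\<close> show ?thesis
    using False p0 by (simp only: of_bool_shift_eq_sum det_circulant if_False zero_less_power)
qed

lemma det_entry_Suc:
  fixes p :: nat and u :: int
  assumes p: "prime p" "odd p" and u: "\<not> int p dvd u" and d: "1 \<le> d" "d < p"
  shows "det_on {0..<int p ^ Suc n} (entry (int p ^ Suc n) (1 + int p * u) d) =
    (if n = 0 then 1 else int d) ^ (p - 1) *
    det_on {0..<int p ^ n} (entry (int p ^ n) (1 + int p * u) d)"
proof -
  let ?U = "{x \<in> {0..<int p ^ Suc n}. \<not> int p dvd x}"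
    and ?M = "{x \<in> {0..<int p ^ Suc n}. int p dvd x}"
    and ?E = "entry (int p ^ Suc n) (1 + int p * u) d"
  have fin: "finite {x \<in> {0..<int p ^ Suc n}. P x}" for P
    by (rule finite_subset[OF _ finite_atLeastLessThan_int]) (rule Collect_subset)
  have "det_on {0..<int p ^ Suc n} ?E = det_on (?U \<union> ?M) ?E"
    by (rule arg_cong2[of _ _ _ _ det_on]) auto
  also have "\<dots> = det_on ?U ?E * det_on ?M ?E"
  proof (rule det_on_union)
    show "?E x y = 0" if "x \<in> ?U" "y \<in> ?M" for x y
      using that entry_unit_multiple[OF p(1)] by blast
  qed (rule fin | simp add: disjoint_iff)+
  finally show ?thesis
    unfolding det_entry_units[OF p u] det_cyclic_block[OF p(1) d]
      det_entry_multiples[OF prime_gt_0_nat[OF p(1)]] .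
qed

text \<open>Passing from modulus \<open>1\<close> to modulus \<open>p\<close> contributes a factor
  \<open>1\<close>, and each of the \<open>n\<close> later steps contributes
  \<open>d^(p-1)\<close>.\<close>

lemma det_entry_odd:
  fixes p :: nat and u :: int
  assumes "prime p" "odd p" "\<not> int p dvd u" "1 \<le> d" "d < p"
  shows "det_on {0..<int p ^ Suc n} (entry (int p ^ Suc n) (1 + int p * u) d) = int d ^ ((p - 1) * n)"
proof (induction n)
  case 0
  show ?case
    unfolding det_entry_Suc[OF assms, of 0]
    by (subst det_on_identity) (use assms in \<open>auto simp: entry_def intro!: exI[of _ 0]\<close>)
next
  case (Suc n)
  then show ?case
    unfolding det_entry_Suc[OF assms, of "Suc n"] by (simp add: power_add)
qed

section \<open>Vanishing for \<open>n \<ge> 2\<close> and \<open>d \<ge> p\<close>\<close>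

lemma det_on_equal_rows:
  assumes "finite S" "x \<in> S" "y \<in> S" "x \<noteq> y" and eq: "\<And>j. j \<in> S \<Longrightarrow> f x j = f y j"
  shows "det_on S f = 0"
proof -
  obtain g where g: "bij_betw g {0..<card S} S"
    using ex_bij_betw_nat_finite[OF assms(1)] by blast
  then have "x \<in> g ` {0..<card S}" "y \<in> g ` {0..<card S}"
    using assms(2,3) by (simp_all add: bij_betw_imp_surj_on)
  then obtain i k where ik: "i < card S" "x = g i" "k < card S" "y = g k"
    by auto
  let ?A = "mat (card S) (card S) (\<lambda>(i, j). f (g i) (g j))"
  have "g j \<in> S" if "j < card S" for j
    using bij_betwE[OF g] that by simp
  then have "Matrix.row ?A i = Matrix.row ?A k"
    using ik eq by (intro eq_vecI) auto
  then have "det ?A = 0"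
    using ik assms(4) by (intro det_identical_rows[of ?A "card S" i k]) auto
  then show ?thesis
    using det_on_reindex[OF g, of f] by (simp add: det_mat_eq_det_on)
qed

text \<open>The orbit of \<open>p^n\<close> modulo \<open>p^(n+2)\<close> has period
  \<open>p\<close>, so with \<open>d \<ge> p\<close> the rows of \<open>x\<close> and of
  \<open>x * q\<close> are both the indicator of the full orbit. The argument covers
  \<open>p = 2\<close> as well.\<close>

lemma det_entry_large:
  fixes p :: nat and u :: int
  assumes p: "prime p" and u: "\<not> int p dvd u" and d: "p \<le> d"
  shows "det_on {0..<int p ^ (n + 2)} (entry (int p ^ (n + 2)) (1 + int p * u) d) = 0"
proof -
  let ?q = "1 + int p * u" and ?N = "int p ^ (n + 2)"
  have p1: "p > 1"
    using p by (rule prime_gt_1_nat)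
  \<comment> \<open>The exponent lies two below the modulus: \<open>q - 1\<close> has one factor
    \<open>p\<close> and moves \<open>x\<close>, while \<open>q^p - 1\<close> is divisible by
    \<open>p^2\<close> and so \<open>q^p\<close> fixes it.\<close>
  define x where "x = int p ^ n"
  define y where "y = (x * ?q) mod ?N"
  have period: "[x * ?q ^ p = x] (mod ?N)"
  proof -
    obtain z where "?q ^ p = 1 + of_nat p * (int p * u) + of_nat (p choose 2) * (int p * u) ^ 2 + (int p * u) ^ 3 * z"
      using one_plus_power_expansion by blast
    then have "x * ?q ^ p - x = ?N * (u + of_nat (p choose 2) * u ^ 2 + int p * u ^ 3 * z)"
      by (simp add: x_def power_add algebra_simps power2_eq_square power3_eq_cube)
    then show ?thesis
      by (simp add: cong_iff_dvd_diff)
  qed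
  have period_mult: "[x * ?q ^ (p * m + k) = x * ?q ^ k] (mod ?N)" for m k
  proof (induction m)
    case (Suc m)
    have "[x * ?q ^ p * ?q ^ (p * m + k) = x * ?q ^ (p * m + k)] (mod ?N)"
      by (rule cong_mult[OF period cong_refl])
    also have "x * ?q ^ p * ?q ^ (p * m + k) = x * ?q ^ (p * Suc m + k)"
      by (simp add: power_add)
    finally show ?case
      using Suc by (rule cong_trans)
  qed simp
  \<comment> \<open>Any \<open>d\<close> consecutive exponents, whatever the start \<open>c\<close>,
    already reach the whole orbit.\<close>
  have reduce: "(\<exists>k<d. [j = x * ?q ^ (k + c)] (mod ?N)) \<longleftrightarrow> (\<exists>k. [j = x * ?q ^ k] (mod ?N))" for j c
  proof
    assume "\<exists>k. [j = x * ?q ^ k] (mod ?N)"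
    then obtain k where k: "[j = x * ?q ^ k] (mod ?N)"
      by blast
    \<comment> \<open>This is \<open>k - c\<close> modulo \<open>p\<close>, with
      \<open>(p - 1) * c\<close> in place of \<open>-c\<close> to stay within the naturals.\<close>
    let ?k = "(k + (p - 1) * c) mod p"
    have "[x * ?q ^ (?k + c) = x * ?q ^ k] (mod ?N)"
    proof -
      have "p * ((k + (p - 1) * c) div p) + (?k + c) = k + (p - 1) * c + c"
        by simp
      also have "\<dots> = p * c + k"
        using p1 by (cases p) simp_all
      finally show ?thesis
        using cong_trans[OF cong_sym[OF period_mult[of "(k + (p - 1) * c) div p" "?k + c"]]]
          period_mult[of c k] by (simp only:)
    qed
    from cong_trans[OF k cong_sym[OF this]] have "[j = x * ?q ^ (?k + c)] (mod ?N)" .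
    moreover have "?k < d"
      using d p1 by (intro less_le_trans[OF mod_less_divisor]) simp_all
    ultimately show "\<exists>k<d. [j = x * ?q ^ (k + c)] (mod ?N)"
      by blast
  qed blast
  have N: "?N > 0"
    using p1 by simp
  show ?thesis
  proof (rule det_on_equal_rows)
    show "x \<in> {0..<?N}"
      using p1 power_strict_increasing[of n "n + 2" "int p"] by (simp add: x_def)
    show "y \<in> {0..<?N}"
      using N by (simp add: y_def)
    show "x \<noteq> y"
    proof
      assume "x = y"
      moreover have "y mod ?N = (x * ?q) mod ?N"
        unfolding y_def by (rule mod_mod_trivial)
      ultimately have "[x * ?q = x] (mod ?N)"
        by (simp only: cong_def)
      then have "int p ^ Suc n * int p dvd int p ^ Suc n * u"
        by (simp add: cong_iff_dvd_diff x_def power_add algebra_simps)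
      then show False
        using u p1 by simp
    qed
    fix j
    have "[j = y * ?q ^ k] (mod ?N) \<longleftrightarrow> [j = x * ?q ^ (k + 1)] (mod ?N)" for k
      by (simp add: y_def cong_def mod_simps mult.assoc)
    then have "entry ?N ?q d y j = of_bool (\<exists>k<d. [j = x * ?q ^ (k + 1)] (mod ?N))"
      by (simp add: entry_def)
    moreover have "entry ?N ?q d x j = of_bool (\<exists>k<d. [j = x * ?q ^ (k + 0)] (mod ?N))"
      by (simp add: entry_def)
    ultimately show "entry ?N ?q d x j = entry ?N ?q d y j"
      unfolding reduce by simp
  qed simp
qed

theorem theorem5p4:
  fixes p n d :: nat and u :: int
  assumes "p = CARD('p :: prime_card)"
    and "n \<ge> 1" and "d \<ge> 1"
    and "coprime (int p) u"
  shows "det (A_mat p n d u :: 'p padic_int mat) =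
    (if n = 1 then 1
     else if d < p then of_nat d ^ ((p - 1) * (n - 1))
     else 0)"
proof -
  let ?D = "det_on {0..<int p ^ n} (entry (int p ^ n) (1 + int p * u) d)"
  have p: "prime p"
    unfolding assms(1) by (rule prime_card)
  then have p1: "p > 1"
    by (rule prime_gt_1_nat)
  have u: "\<not> int p dvd u"
    using assms(4) p1 by (auto simp: coprime_iff_gcd_eq_1)
  have "?D = (if n = 1 then 1 else if d < p then int d ^ ((p - 1) * (n - 1)) else 0)"
  proof -
    \<comment> \<open>Treating \<open>d = 1\<close> separately disposes of \<open>p = 2\<close> with
      \<open>d < p\<close>; in the third case \<open>1 < d < p\<close> forces \<open>p\<close> to be
      odd.\<close>
    consider "n = 1" | "n \<noteq> 1" "d = 1" | "n \<noteq> 1" "d > 1" "d < p" | "n \<noteq> 1" "p \<le> d"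
      using assms(3) by linarith
    then show ?thesis
    proof cases
      case 1
      have "?D = 1"
        by (intro det_on_identity entry_identity) (use 1 assms(3) in \<open>simp_all add: cong_iff_dvd_diff\<close>)
      with 1 show ?thesis
        by simp
    next
      case 2
      have "?D = 1"
        by (rule det_on_identity) (use 2 in \<open>auto simp: entry_def cong_def\<close>)
      with 2 p1 show ?thesis
        by simp
    next
      case 3
      then have "odd p"
        using p primes_dvd_imp_eq[of 2 p] two_is_prime_nat by auto
      from det_entry_odd[OF p this u assms(3) 3(3), of "n - 1"] 3 assms(2) show ?thesis
        by simp
    next
      case 4
      then obtain m where n: "n = m + 2"
        using assms(2) by (intro that[of "n - 2"]) simp
      have "?D = 0"
        unfolding n by (rule det_entry_large[OF p u 4(2)])
      with 4 show ?thesis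
        by simp
    qed
  qed
  moreover have "det (A_mat p n d u :: 'p padic_int mat) = of_int ?D"
    using assms(3) p1 by (intro det_A_mat) simp_all
  ultimately show ?thesis
    by simp
qed

end
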